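(* Let $(a_0^{(k)},a_\infty^{(k)},\mu_k)$ be a sequence of Lévy triples with Bernstein transforms $$f_k(q)=a_0^{(k)}q+a_\infty^{(k)}+\int_{(0,\infty)}(1-e^{-qx})\,d\mu_k(x)$$ and associated finite measures on $[0,\infty]$ $$d\kappa_k(x)=a_0^{(k)}\,d\delta_0(x)+a_\infty^{(k)}\,d\delta_\infty(x)+(x\wedge1)\,d\mu_k(x).$$ Then the following are equivalent: (i) $f(q):=\lim_{k\to\infty}f_k(q)$ exists for each $q\in(0,\infty)$. (ii) $\kappa_k$ converges to some finite measure $\kappa$ weak-$\star$ on $[0,\infty]$; that is, as $k\to\infty$, $\langle g,\kappa_k\rangle\to\langle g,\kappa\rangle$ for every $g\in C([0,\infty])$. If either condition holds, then the limits $f$, $\kappa$ correspond to a unique Lévy triple $(a_0,a_\infty,\mu)$ via $f(q)=a_0q+a_\infty+\int_{(0,\infty)}(1-e^{-qx})\,d\mu(x)$ and $d\kappa(x)=a_0\,d\delta_0(x)+a_\infty\,d\delta_\infty(x)+(x\wedge1)\,d\mu(x)$ respectively.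
   Context: A Lévy triple is $(a_0,a_\infty,\mu)$ with $a_0,a_\infty\ge 0$ and $\mu$ a nonnegative measure on $(0,\infty)$ with $\int_{(0,\infty)}(x\wedge 1)\,d\mu(x)<\infty$. $\delta_x$ is the Dirac mass at $x$, $x\wedge1=\min(x,1)$, and $\langle g,\kappa\rangle=\int_{[0,\infty]}g\,d\kappa$. *)

theory Defs
  imports "HOL-Probability.Probability"
begin

text \<open>A triple \<open>(a\<^sub>0, a\<^sub>\<infinity>, \<mu>)\<close>. The measure lives on the trace of the Borel
  sets on \<open>(0,\<infinity>)\<close>, so equality of triples is equality of Borel measures on \<open>(0,\<infinity>)\<close>.\<close>

type_synonym triple = "real \<times> real \<times> real measure"

fun levy_triple :: "triple \<Rightarrow> bool" where
  "levy_triple (a_zero, a_inf, \<mu>) \<longleftrightarrow>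
     a_zero \<ge> 0 \<and> a_inf \<ge> 0 \<and>
     sets \<mu> = sets (restrict_space borel {0<..}) \<and>
     (\<integral>\<^sup>+x. ennreal (min x 1) \<partial>\<mu>) < \<infinity>"

fun bernstein :: "triple \<Rightarrow> real \<Rightarrow> real" where
  "bernstein (a_zero, a_inf, \<mu>) q = a_zero * q + a_inf + (LINT x|\<mu>. 1 - exp (- q * x))"

text \<open>The interval \<open>[0,\<infinity>]\<close> is the compact space \<^typ>\<open>ennreal\<close>; the measure
  \<open>(x \<and> 1) d\<mu>\<close> is transported to it along the inclusion \<^const>\<open>ennreal\<close>.\<close>

fun kappa :: "triple \<Rightarrow> ennreal measure" where
  "kappa (a_zero, a_inf, \<mu>) = measure_of UNIV (sets borel)
     (\<lambda>A. ennreal a_zero * emeasure (return borel 0) A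
        + ennreal a_inf * emeasure (return borel \<infinity>) A
        + emeasure (distr (density \<mu> (\<lambda>x. ennreal (min x 1))) borel ennreal) A)"

definition finite_measure_extended :: "ennreal measure \<Rightarrow> bool" where
  "finite_measure_extended \<kappa> \<longleftrightarrow> sets \<kappa> = sets borel \<and> finite_measure \<kappa>"

definition weak_star_limit :: "(nat \<Rightarrow> ennreal measure) \<Rightarrow> ennreal measure \<Rightarrow> bool" where
  "weak_star_limit \<kappa>s \<kappa> \<longleftrightarrow>
     (\<forall>g :: ennreal \<Rightarrow> real. continuous_on UNIV g \<longrightarrow>
        (\<lambda>k. integral\<^sup>L (\<kappa>s k) g) \<longlonglongrightarrow> integral\<^sup>L \<kappa> g)"

text \<open>The set function in the definition of \<^const>\<open>kappa\<close> is a measure, so that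
  \<^const>\<open>measure_of\<close> does not collapse to the null measure, and the Bernstein integral
  converges.\<close>

declare kappa.simps [simp del]

lemma sets_kappa [simp]: "sets (kappa T) = sets borel"
proof (cases T)
  case (fields a_zero a_inf \<mu>)
  show ?thesis
    unfolding fields kappa.simps using sets.sigma_sets_eq[of "borel :: ennreal measure"]
    by (subst sets_measure_of) (auto simp only: space_borel top_greatest Pow_UNIV)
qed

lemma space_kappa [simp]: "space (kappa T) = UNIV"
  using sets_eq_imp_space_eq[OF sets_kappa] by (simp only: space_borel)

lemma emeasure_kappa:
  assumes "A \<in> sets borel"
  shows "emeasure (kappa (a_zero, a_inf, \<mu>)) A =
      ennreal a_zero * emeasure (return borel 0) A
    + ennreal a_inf * emeasure (return borel \<infinity>) A
    + emeasure (distr (density \<mu> (\<lambda>x. ennreal (min x 1))) borel ennreal) A"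
    (is "_ = ?m A")
proof (rule emeasure_measure_of[OF kappa.simps])
  show "sets borel \<subseteq> Pow UNIV" by simp
  show "A \<in> sets (kappa (a_zero, a_inf, \<mu>))" using assms by (simp only: sets_kappa)
  show "positive (sets (kappa (a_zero, a_inf, \<mu>))) ?m"
    by (simp only: positive_def emeasure_empty mult_zero_right add_0)
  show "countably_additive (sets (kappa (a_zero, a_inf, \<mu>))) ?m"
  proof (rule countably_additiveI, unfold sets_kappa)
    fix F :: "nat \<Rightarrow> ennreal set"
    assume F: "range F \<subseteq> sets borel" "disjoint_family F"
    have s: "(\<Sum>i. emeasure M (F i)) = emeasure M (\<Union>i. F i)" if "sets M = sets borel" for M
      using F that by (intro suminf_emeasure) auto
    show "(\<Sum>i. ?m (F i)) = ?m (\<Union>i. F i)"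
      by (simp only: suminf_add[symmetric, OF summableI summableI] ennreal_suminf_cmult
          s sets_return sets_distr)
  qed
qed

lemma finite_measure_extended_kappa:
  assumes "levy_triple T"
  shows "finite_measure_extended (kappa T)"
proof (cases T)
  case (fields a_zero a_inf \<mu>)
  have s: "sets \<mu> = sets (restrict_space borel {0<..})"
    and f: "(\<integral>\<^sup>+x. ennreal (min x 1) \<partial>\<mu>) < \<infinity>"
    using assms by (auto simp: fields)
  have m [measurable]: "h \<in> borel_measurable \<mu>" if "h \<in> borel_measurable borel"
    for h :: "real \<Rightarrow> ennreal"
    unfolding measurable_cong_sets[OF s refl] using that by (rule measurable_restrict_space1)
  let ?D = "density \<mu> (\<lambda>x. ennreal (min x 1))"
  have e: "ennreal \<in> measurable ?D borel"
    unfolding measurable_cong_sets[OF sets_density refl] by (rule m) (rule measurable_ennreal)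
  have "emeasure (distr ?D borel ennreal) UNIV = emeasure ?D (space \<mu>)"
    using emeasure_distr[OF e, of UNIV] by (simp only: vimage_UNIV Int_UNIV_left space_density
        sets.top[of borel, unfolded space_borel])
  also have "\<dots> = (\<integral>\<^sup>+x. ennreal (min x 1) * indicator (space \<mu>) x \<partial>\<mu>)"
    by (rule emeasure_density) (auto intro: m)
  also have "\<dots> = (\<integral>\<^sup>+x. ennreal (min x 1) \<partial>\<mu>)"
    by (intro nn_integral_cong) (simp only: indicator_simps mult_1_right)
  finally have d: "emeasure (distr ?D borel ennreal) UNIV < \<infinity>" using f by (simp only:)
  have "emeasure (kappa T) UNIV =
      ennreal a_zero + ennreal a_inf + emeasure (distr ?D borel ennreal) UNIV"
    unfolding fields by (subst emeasure_kappa) simp_all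
  then have "emeasure (kappa T) UNIV < \<infinity>"
    using d by simp
  then show ?thesis
    unfolding finite_measure_extended_def
    by (intro conjI sets_kappa finite_measureI) (simp only: space_kappa infinity_ennreal_def less_top)
qed

lemma integrable_bernstein:
  assumes "levy_triple (a_zero, a_inf, \<mu>)" "q > 0"
  shows "integrable \<mu> (\<lambda>x. 1 - exp (- q * x))"
proof -
  have s: "sets \<mu> = sets (restrict_space borel {0<..})"
    and f: "(\<integral>\<^sup>+x. ennreal (min x 1) \<partial>\<mu>) < \<infinity>"
    using assms by auto
  have sp: "space \<mu> = {0<..}"
    using sets_eq_imp_space_eq[OF s] by (simp add: space_restrict_space)
  have m [measurable]: "h \<in> borel_measurable \<mu>" if "h \<in> borel_measurable borel"
    for h :: "real \<Rightarrow> real"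
    unfolding measurable_cong_sets[OF s refl] using that by (rule measurable_restrict_space1)
  have i: "integrable \<mu> (\<lambda>x. min x 1)"
  proof (rule integrableI_bounded)
    have "(\<integral>\<^sup>+x. ennreal (norm (min x 1)) \<partial>\<mu>) = (\<integral>\<^sup>+x. ennreal (min x 1) \<partial>\<mu>)"
      by (intro nn_integral_cong) (simp add: sp)
    then show "(\<integral>\<^sup>+x. ennreal (norm (min x 1)) \<partial>\<mu>) < \<infinity>" using f by simp
  qed simp
  show ?thesis
  proof (rule Bochner_Integration.integrable_bound)
    show "integrable \<mu> (\<lambda>x. max q 1 * min x 1)" using i by simp
    have "norm (1 - exp (- q * x)) \<le> norm (max q 1 * min x 1)" if "x > 0" for x
    proof -
      have u: "1 - exp (- q * x) \<le> 1" and n: "0 \<le> 1 - exp (- q * x)"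
        using that assms(2) by simp_all
      have "1 - exp (- q * x) \<le> max q 1 * min x 1"
      proof (cases "x \<le> 1")
        case True
        have "1 - exp (- q * x) \<le> q * x" using exp_ge_add_one_self[of "- q * x"] by simp
        also have "\<dots> \<le> max q 1 * x" using that by (intro mult_right_mono) auto
        finally show ?thesis using True by simp
      next
        case False
        then have "max q 1 * min x 1 = max q 1" by simp
        then show ?thesis using u by linarith
      qed
      with n show ?thesis unfolding real_norm_def by linarith
    qed
    then show "AE x in \<mu>. norm (1 - exp (- q * x)) \<le> norm (max q 1 * min x 1)"
      by (intro AE_I2) (simp only: sp greaterThan_iff)
  qed simp
qed

end

theory Submission
  imports Defs
begin

text \<open>
  Let \<open>h\<^sub>q(x) = (1 - e\<^sup>-\<^sup>q\<^sup>x) / (x \<and> 1)\<close>, with \<open>h\<^sub>q(0) = q\<close> and \<open>h\<^sub>q(\<infinity>) = 1\<close>. This is a continuous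
  positive function on the compact space \<open>[0,\<infinity>]\<close> (\<open>continuous_on_bernstein_kernel\<close>), and the
  Bernstein transform of a triple at \<open>q\<close> is the integral of \<open>h\<^sub>q\<close> against the associated measure
  \<open>\<kappa>\<close> (\<open>bernstein_eq_integral_kappa\<close>). Weak-star convergence therefore implies pointwise
  convergence of the transforms at once.

  Conversely, \<open>h\<^bsub>n+1\<^esub> - h\<^sub>n = u\<^sup>n h\<^sub>1\<close> for \<open>n \<ge> 1\<close>, where \<open>u = e\<^sup>-\<^sup>x\<close>. So the transforms at the
  positive integers determine the integrals of \<open>p(u) h\<^sub>1\<close> for all polynomials \<open>p\<close>, and by the
  theorem of Stone and Weierstrass these functions are dense in the continuous functions. As the
  masses are bounded, all integrals of continuous functions converge
  (\<open>convergent_integral_continuous\<close>). That the limit functional is integration against a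
  measure follows from compactness: Helly's theorem in the coordinate \<open>u \<in> [0,1]\<close>
  (\<open>weak_star_limit_exists\<close>).

  Every finite Borel measure on \<open>[0,\<infinity>]\<close> comes from exactly one Levy triple (\<open>kappa_levy_of\<close>,
  \<open>levy_of_kappa\<close>), which gives the triple of the limit and its uniqueness given \<open>\<kappa>\<close>. Uniqueness
  given \<open>f\<close> holds because equal transforms have equal measures (\<open>kappa_eq_of_bernstein_eq\<close>).
\<close>

section \<open>The interval \<open>[0,\<infinity>]\<close> in exponential coordinates\<close>

text \<open>The coordinate \<open>u = e\<^sup>-\<^sup>x\<close> identifies \<open>[0,\<infinity>]\<close> with \<open>[0,1]\<close>. It turns the increments of a Bernstein
  transform along the integers into moments, and it carries measures to the real line, where
  the selection theorem of Helly applies.\<close>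

definition expn :: "ennreal \<Rightarrow> real" where
  "expn x = (if x = \<top> then 0 else exp (- enn2real x))"

text \<open>The inverse coordinate, extended to the real line by \<open>\<infinity>\<close> on the left and by \<open>0\<close> on the
  right, since \<^const>\<open>ennreal\<close> sends negative numbers to \<open>0\<close>.\<close>

definition neg_ln :: "real \<Rightarrow> ennreal" where
  "neg_ln u = (if u \<le> 0 then \<top> else ennreal (- ln u))"

lemma expn_simps [simp]: "expn \<top> = 0" "expn 0 = 1" "0 \<le> x \<Longrightarrow> expn (ennreal x) = exp (- x)"
  by (auto simp: expn_def)

lemma expn_nonneg: "0 \<le> expn x" and expn_le_1: "expn x \<le> 1"
  by (auto simp: expn_def)

lemma expn_less_iff: "expn x < expn y \<longleftrightarrow> y < x"
  by (cases x; cases y) (auto simp: ennreal_less_iff)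

lemma neg_ln_expn [simp]: "neg_ln (expn x) = x"
  by (cases x) (auto simp: neg_ln_def)

lemma expn_neg_ln: "u \<in> {0..1} \<Longrightarrow> expn (neg_ln u) = u"
  by (auto simp: neg_ln_def)

lemma neg_ln_image: "neg_ln ` {0..1} = UNIV"
proof -
  have "x \<in> neg_ln ` {0..1}" for x
    by (rule image_eqI[of _ _ "expn x"]) (auto simp: expn_nonneg expn_le_1)
  then show ?thesis by auto
qed

text \<open>A monotone function whose image is open is continuous. The criterion is stated for
  increasing functions, hence the reflection \<open>u \<mapsto> 1 - u\<close>. Continuity of this inverse coordinate is
  all that has to be checked: compactness of \<open>[0,\<infinity>]\<close> and continuity of \<^const>\<open>expn\<close> follow from it.\<close>

lemma continuous_on_neg_ln: "continuous_on {0..1} neg_ln"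
proof -
  have "(\<lambda>u::real. 1 - u) ` {0..1} = {0..1}" by simp
  then have "open ((\<lambda>u. neg_ln (1 - u)) ` {0..1})"
    using neg_ln_image by (metis image_image open_UNIV)
  then have "continuous_on {0..1} (\<lambda>u. neg_ln (1 - u))"
    by (rule continuous_onI_mono) (auto simp: neg_ln_def intro!: ennreal_leI)
  from continuous_on_compose2[OF this, of "{0..1}" "\<lambda>u. 1 - u"]
  show ?thesis by (simp add: continuous_on_diff)
qed

lemma compact_UNIV_ennreal: "compact (UNIV :: ennreal set)"
  using compact_continuous_image[OF continuous_on_neg_ln] by (simp add: neg_ln_image)

lemma continuous_on_expn: "continuous_on UNIV expn"
  using continuous_on_inv[OF continuous_on_neg_ln compact_Icc, of expn]
  by (simp add: neg_ln_image expn_neg_ln)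

lemma continuous_bounded_ennreal:
  fixes g :: "ennreal \<Rightarrow> real"
  assumes "continuous_on UNIV g"
  obtains B where "\<And>x. \<bar>g x\<bar> \<le> B"
  using compact_imp_bounded[OF compact_continuous_image[OF assms compact_UNIV_ennreal]]
  by (auto simp: bounded_iff)

lemma integrable_continuous_ennreal:
  fixes g :: "ennreal \<Rightarrow> real"
  assumes "finite_measure_extended \<kappa>" "continuous_on UNIV g"
  shows "integrable \<kappa> g"
proof -
  interpret finite_measure \<kappa> using assms(1) by (simp add: finite_measure_extended_def)
  have s: "sets \<kappa> = sets borel" using assms(1) by (simp add: finite_measure_extended_def)
  obtain B where "\<And>x. \<bar>g x\<bar> \<le> B" using continuous_bounded_ennreal[OF assms(2)] by blast
  then show ?thesis
    by (intro integrable_const_bound[of _ B])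
      (auto simp: measurable_cong_sets[OF s refl] intro: borel_measurable_continuous_onI assms)
qed

lemma continuous_on_enn2real:
  fixes f :: "'a::topological_space \<Rightarrow> ennreal"
  assumes "continuous_on S f" "\<And>x. x \<in> S \<Longrightarrow> f x \<noteq> \<top>"
  shows "continuous_on S (\<lambda>x. enn2real (f x))"
  unfolding continuous_on_def
proof
  fix x assume x: "x \<in> S"
  have "(f \<longlongrightarrow> ennreal (enn2real (f x))) (at x within S)"
    using assms x by (simp add: continuous_on_def less_top)
  then show "((\<lambda>x. enn2real (f x)) \<longlongrightarrow> enn2real (f x)) (at x within S)"
    by (rule tendsto_enn2real) simp
qed

section \<open>Bernstein transforms as integrals of continuous functions\<close>

text \<open>The function \<open>(1 - e\<^sup>-\<^sup>q\<^sup>x) / (x \<and> 1)\<close> on \<open>(0,\<infinity>)\<close>, with its limits \<open>q\<close> at \<open>0\<close> and \<open>1\<close> at \<open>\<infinity>\<close>.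
  At \<open>\<infinity>\<close> no case distinction is needed, because \<open>0 powr q = 0\<close>.\<close>

definition bernstein_kernel :: "real \<Rightarrow> ennreal \<Rightarrow> real" where
  "bernstein_kernel q x = (if x = 0 then q else (1 - expn x powr q) / enn2real (min x 1))"

lemma bernstein_kernel_simps [simp]: "bernstein_kernel q 0 = q" "bernstein_kernel q \<top> = 1" 
  by (auto simp: bernstein_kernel_def)

lemma bernstein_kernel_ennreal: "0 < x \<Longrightarrow> bernstein_kernel q (ennreal x) = (1 - exp (- q * x)) / min x 1"
  by (simp add: bernstein_kernel_def min_def exp_powr_real mult.commute flip: ennreal_le_1)

lemma bernstein_kernel_pos: "0 < q \<Longrightarrow> 0 < bernstein_kernel q x"
  by (cases x) (auto simp: bernstein_kernel_def exp_powr_real min_def top_unique intro!: divide_pos_pos)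

text \<open>Away from \<open>0\<close> this is a quotient of continuous functions. Near \<open>0\<close> it is a difference
  quotient of \<open>1 - e\<^sup>-\<^sup>q\<^sup>r\<close>, whose derivative at \<open>0\<close> is \<open>q\<close>.\<close>

lemma continuous_on_bernstein_kernel:
  assumes "0 < q"
  shows "continuous_on UNIV (bernstein_kernel q)"
proof -
  have "continuous_on {0<..} (\<lambda>x. (1 - expn x powr q) / enn2real (min x 1))"
  proof (intro continuous_on_divide continuous_on_diff continuous_on_const)
    show "continuous_on {0<..} (\<lambda>x. expn x powr q)"
     using assms continuous_on_subset[OF continuous_on_expn]
     by (intro continuous_on_powr' continuous_intros) (auto simp: expn_nonneg)
    show "continuous_on {0<..} (\<lambda>x::ennreal. enn2real (min x 1))"
      by (intro continuous_on_enn2real continuous_on_min continuous_on_id continuous_on_const)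
        (simp add: less_top min_less_iff_disj)
    show "\<forall>x\<in>{0<..}. enn2real (min x 1) \<noteq> 0"
      by (auto simp: min_def enn2real_eq_0_iff top_unique)
  qed
  then have 1: "continuous_on {0<..} (bernstein_kernel q)"
    by (rule continuous_on_eq) (auto simp: bernstein_kernel_def)
  let ?f = "\<lambda>r::real. if r = 0 then q else (1 - exp (- q * r)) / r"
  have "isCont ?f r" for r
  proof (cases "r = 0")
    case True
    have "((\<lambda>r::real. (1 - exp (- q * r)) / r) \<longlongrightarrow> q) (at 0)"
    proof -
      have "((\<lambda>r. 1 - exp (- q * r)) has_real_derivative q) (at 0)"
        by (auto intro!: derivative_eq_intros)
      then show ?thesis by (simp add: has_field_derivative_iff)
    qed
    then have "(?f \<longlongrightarrow> q) (at 0)"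
      by (rule Lim_transform_eventually) (auto simp: eventually_at_filter)
    then show ?thesis by (simp add: True isCont_def)
  next
    case False
    have "continuous_on (- {0}) ?f"
      by (rule continuous_on_eq[of _ "\<lambda>r. (1 - exp (- q * r)) / r"]) (auto intro!: continuous_intros)
    moreover have "open (- {0::real})" by auto
    ultimately show ?thesis
      using False continuous_on_eq_continuous_at[of "- {0}" ?f] by blast
  qed
  then have f: "continuous_on UNIV ?f" by (simp add: continuous_on_eq_continuous_at)
  have "continuous_on {..<1} enn2real"
    by (rule continuous_on_enn2real) auto
  then have "continuous_on {..<1} (\<lambda>x. ?f (enn2real x))"
    by (rule continuous_on_compose2[OF f]) auto
  then have 2: "continuous_on {..<1} (bernstein_kernel q)"
  proof (rule continuous_on_eq)
    fix x :: ennreal assume "x \<in> {..<1}"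
    then show "?f (enn2real x) = bernstein_kernel q x"
      by (cases x) (auto simp: bernstein_kernel_ennreal min_def le_less)
  qed
  have "{..<1} \<union> {0<..} = (UNIV :: ennreal set)" 
    by (auto simp: less_le)
  then show ?thesis
    using continuous_on_open_Un[OF _ _ 2 1] by simp
qed

lemma nn_integral_kappa:
  assumes [measurable]: "g \<in> borel_measurable borel"
  shows "integral\<^sup>N (kappa (a, b, \<mu>)) g = ennreal a * integral\<^sup>N (return borel 0) g
    + ennreal b * integral\<^sup>N (return borel \<infinity>) g
    + integral\<^sup>N (distr (density \<mu> (\<lambda>x. ennreal (min x 1))) borel ennreal) g"
  (is "?K g = ennreal a * ?A g + ennreal b * ?B g + ?D g")
  using assms
proof induct
  case (cong f g)
  then have "f = g" by auto
  with cong show ?case by simp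
next
  case (set A)
  then show ?case by (simp add: emeasure_kappa)
next
  case (mult u c)
  have m: "u \<in> borel_measurable M" if "sets M = sets borel" for M
    using mult that by (simp add: measurable_cong_sets[OF that refl])
  show ?case
    using mult by (simp add: nn_integral_cmult m distrib_left mult.left_commute del: nn_integral_return)
next
  case (add u v)
  have m: "u \<in> borel_measurable M" "v \<in> borel_measurable M" if "sets M = sets borel" for M
    using add that by (simp_all add: measurable_cong_sets[OF that refl])
  show ?case
    using add by (simp add: nn_integral_add m distrib_left ac_simps del: nn_integral_return)
next
  case (seq U)
  have m: "U i \<in> borel_measurable M" if "sets M = sets borel" for M i
    using seq that by (simp add: measurable_cong_sets[OF that refl])
  have IH: "?K (U i) = ennreal a * ?A (U i) + ennreal b * ?B (U i) + ?D (U i)" for i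
    using seq by blast
  have Sup: "Sup (range U) = (\<lambda>x. SUP i. U i x)"
    by (rule ext) (rule SUP_apply)
  have s: "integral\<^sup>N M (Sup (range U)) = (SUP i. integral\<^sup>N M (U i))" if "sets M = sets borel" for M
    unfolding Sup using nn_integral_monotone_convergence_SUP[OF \<open>incseq U\<close> m[OF that]] .
  have i: "incseq (\<lambda>i. integral\<^sup>N M (U i))" for M
    using \<open>incseq U\<close> by (auto simp: incseq_def le_fun_def intro!: nn_integral_mono)
  have "?K (Sup (range U)) = (SUP i. ennreal a * ?A (U i) + ennreal b * ?B (U i) + ?D (U i))"
    by (simp only: s[OF sets_kappa] IH)
  also have "\<dots> = (SUP i. ennreal a * ?A (U i)) + (SUP i. ennreal b * ?B (U i)) + (SUP i. ?D (U i))"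
    using i[THEN incseqD]
    by (simp add: ennreal_SUP_add incseq_def add_mono mult_left_mono del: nn_integral_return)
  also have "\<dots> = ennreal a * ?A (Sup (range U)) + ennreal b * ?B (Sup (range U)) + ?D (Sup (range U))"
    by (simp only: s sets_return sets_distr SUP_mult_left_ennreal)
  finally show ?case .
qed

text \<open>The weight \<open>x \<and> 1\<close> in \<^const>\<open>kappa\<close> cancels the denominator of the kernel, and the two
  boundary values \<open>q\<close> and \<open>1\<close> are what the drift and the killing term contribute.\<close>

lemma bernstein_eq_integral_kappa:
  assumes "levy_triple T" "0 < q"
  shows "bernstein T q = integral\<^sup>L (kappa T) (bernstein_kernel q)"
proof (cases T)
  case (fields a b \<mu>)
  have ab: "0 \<le> a" "0 \<le> b" and s: "sets \<mu> = sets (restrict_space borel {0<..})"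
    using assms(1) by (auto simp: fields)
  have sp: "space \<mu> = {0<..}"
    using sets_eq_imp_space_eq[OF s] by (simp add: space_restrict_space)
  have m [measurable]: "h \<in> borel_measurable \<mu>" if "h \<in> borel_measurable borel"
    for h :: "real \<Rightarrow> ennreal"
    unfolding measurable_cong_sets[OF s refl] using that by (rule measurable_restrict_space1)
  have k [measurable]: "bernstein_kernel q \<in> borel_measurable borel"
    by (intro borel_measurable_continuous_onI continuous_on_bernstein_kernel assms)
  have e: "0 \<le> 1 - exp (- q * x)" if "0 < x" for x
    using that assms(2) by simp
  have i: "0 \<le> (LINT x|\<mu>. 1 - exp (- q * x))"
    by (intro integral_nonneg_AE AE_I2) (use e sp in auto)
  have "(\<integral>\<^sup>+x. ennreal (bernstein_kernel q x) \<partial>distr (density \<mu> (\<lambda>x. ennreal (min x 1))) borel ennreal)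
      = (\<integral>\<^sup>+x. ennreal (min x 1) * ennreal (bernstein_kernel q (ennreal x)) \<partial>\<mu>)"
    by (subst nn_integral_distr) (auto simp: nn_integral_density)
  also have "\<dots> = (\<integral>\<^sup>+x. ennreal (1 - exp (- q * x)) \<partial>\<mu>)"
    by (intro nn_integral_cong) (auto simp: sp bernstein_kernel_ennreal simp flip: ennreal_mult')
  also have "\<dots> = ennreal (LINT x|\<mu>. 1 - exp (- q * x))"
    using integrable_bernstein[of a b \<mu> q] assms e
    by (intro nn_integral_eq_integral AE_I2) (auto simp: fields sp)
  finally have n: "(\<integral>\<^sup>+x. ennreal (bernstein_kernel q x) \<partial>kappa T) = ennreal (bernstein T q)"
    using ab i assms(2)
    by (simp add: fields nn_integral_kappa nn_integral_return ennreal_mult' ennreal_plus)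
  have k': "bernstein_kernel q \<in> borel_measurable (kappa T)"
    unfolding measurable_cong_sets[OF sets_kappa refl] by (rule k)
  have "0 \<le> bernstein T q" using ab i assms(2) by (simp add: fields)
  with n show ?thesis
    using bernstein_kernel_pos[OF assms(2)]
    by (subst integral_eq_nn_integral[OF k']) (auto simp: less_imp_le)
qed

section \<open>Convergence of transforms gives convergence of all continuous integrals\<close>

text \<open>With respect to the measure with density \<open>bernstein_kernel 1\<close>, the powers of \<open>e\<^sup>-\<^sup>x\<close> thus integrate
  to increments of the Bernstein transform. The power \<open>0\<close> is excluded, since at \<open>\<infinity>\<close> the left side
  would be \<open>1\<close>; the total mass is the value of the transform at \<open>1\<close> instead.\<close>

lemma expn_power_bernstein_kernel:
  "0 < n \<Longrightarrow> expn x ^ n * bernstein_kernel 1 x = bernstein_kernel (real (Suc n)) x - bernstein_kernel (real n) x"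
proof (cases x)
  case (real r)
  then show ?thesis
    by (cases "r = 0")
      (simp_all add: bernstein_kernel_ennreal exp_of_nat_mult[symmetric] algebra_simps
        exp_add[symmetric] diff_divide_distrib[symmetric])
qed auto

lemma convergent_uniform_approx:
  fixes u :: "nat \<Rightarrow> real"
  assumes "\<And>e. 0 < e \<Longrightarrow> \<exists>v. convergent v \<and> (\<forall>k. \<bar>u k - v k\<bar> \<le> e)"
  shows "convergent u"
proof (rule Cauchy_convergent, rule metric_CauchyI)
  fix e :: real assume "0 < e"
  then obtain v where v: "convergent v" "\<And>k. \<bar>u k - v k\<bar> \<le> e / 4"
    using assms[of "e / 4"] by auto
  obtain N where N: "\<And>m n. N \<le> m \<Longrightarrow> N \<le> n \<Longrightarrow> dist (v m) (v n) < e / 4"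
    using metric_CauchyD[OF convergent_Cauchy[OF v(1)], of "e / 4"] \<open>0 < e\<close> by auto
  have "dist (u m) (u n) < e" if "N \<le> m" "N \<le> n" for m n
    using N[OF that] v(2)[of m] v(2)[of n] unfolding dist_real_def by linarith
  then show "\<exists>M. \<forall>m\<ge>M. \<forall>n\<ge>M. dist (u m) (u n) < e" by blast
qed

lemma poly_expn_dense:
  assumes "continuous_on UNIV g" "0 < e"
  obtains p where "\<And>x. \<bar>g x - poly p (expn x)\<bar> < e"
proof -
  interpret function_ring_on "{\<lambda>x. poly p (expn x) |p. True}" UNIV
  proof
    show "compact (UNIV :: ennreal set)" by (rule compact_UNIV_ennreal)
    fix f g :: "ennreal \<Rightarrow> real"
    let ?R = "{\<lambda>x. poly p (expn x) |p. True}"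
    { assume "f \<in> ?R"
      then show "continuous_on UNIV f"
        by (auto intro!: continuous_on_poly continuous_on_expn) }
    assume "f \<in> ?R" "g \<in> ?R"
    then obtain p r where p: "f = (\<lambda>x. poly p (expn x))" "g = (\<lambda>x. poly r (expn x))" by auto
    show "(\<lambda>x. f x + g x) \<in> ?R" by (auto simp: p intro!: exI[of _ "p + r"])
    show "(\<lambda>x. f x * g x) \<in> ?R" by (auto simp: p intro!: exI[of _ "p * r"])
  next
    fix c :: real 
    show "(\<lambda>_. c) \<in> {\<lambda>x. poly p (expn x) |p. True}" by (auto intro!: exI[of _ "[:c:]"])
  next
    fix x y :: ennreal assume "x \<noteq> y"
    then have "expn x \<noteq> expn y" by (metis neg_ln_expn)
    then show "\<exists>f\<in>{\<lambda>x. poly p (expn x) |p. True}. f x \<noteq> f y"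
      by (intro bexI[of _ "\<lambda>x. poly [:0, 1:] (expn x)"]) (simp, blast)
  qed
  show thesis using Stone_Weierstrass_basic[OF assms] that by auto
qed

text \<open>The moments converge by the increment formula, so integrals of polynomials in \<open>e\<^sup>-\<^sup>x\<close> against
  \<open>bernstein_kernel 1\<close> converge. The kernel is positive, so every continuous \<open>g\<close> is the kernel
  times a continuous function, which is a uniform limit of such polynomials; the error is uniform
  in \<open>k\<close> because the integrals of \<open>bernstein_kernel 1\<close> converge and hence are bounded.\<close>

lemma convergent_integral_continuous:
  fixes \<kappa> :: "nat \<Rightarrow> ennreal measure" and g :: "ennreal \<Rightarrow> real"
  assumes fin: "\<And>k. finite_measure_extended (\<kappa> k)"
    and conv: "\<And>q. 0 < q \<Longrightarrow> convergent (\<lambda>k. integral\<^sup>L (\<kappa> k) (bernstein_kernel q))"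
    and g: "continuous_on UNIV g"
  shows "convergent (\<lambda>k. integral\<^sup>L (\<kappa> k) g)"
proof -
  note int = integrable_continuous_ennreal[OF fin]
  note ck = continuous_on_bernstein_kernel[of 1, simplified]
  have moment: "convergent (\<lambda>k. LINT x|\<kappa> k. expn x ^ n * bernstein_kernel 1 x)" for n
  proof (cases n)
    case 0
    then show ?thesis using conv[of 1] by simp
  next
    case (Suc m)
    have "(LINT x|\<kappa> k. expn x ^ n * bernstein_kernel 1 x)
        = integral\<^sup>L (\<kappa> k) (bernstein_kernel (Suc n)) - integral\<^sup>L (\<kappa> k) (bernstein_kernel n)" for k
    proof -
      have "(LINT x|\<kappa> k. expn x ^ n * bernstein_kernel 1 x)
          = (LINT x|\<kappa> k. bernstein_kernel (Suc n) x - bernstein_kernel n x)"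
        using Suc by (subst expn_power_bernstein_kernel) simp_all
      also have "\<dots> = integral\<^sup>L (\<kappa> k) (bernstein_kernel (Suc n)) - integral\<^sup>L (\<kappa> k) (bernstein_kernel n)"
        using Suc by (intro Bochner_Integration.integral_diff int continuous_on_bernstein_kernel) simp_all
      finally show ?thesis .
    qed
    then show ?thesis
      using Suc by (simp only:) (intro convergent_diff conv; simp)
  qed
  have poly: "convergent (\<lambda>k. LINT x|\<kappa> k. poly p (expn x) * bernstein_kernel 1 x)" for p
  proof -
    have "(LINT x|\<kappa> k. poly p (expn x) * bernstein_kernel 1 x)
       = (\<Sum>i\<le>degree p. coeff p i * (LINT x|\<kappa> k. expn x ^ i * bernstein_kernel 1 x))" for k
      unfolding poly_altdef sum_distrib_right mult.assoc
      by (subst Bochner_Integration.integral_sum)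
        (auto intro!: int continuous_intros continuous_on_expn ck)
    then show ?thesis
      by (simp only:) (intro convergent_sum convergent_mult convergent_const moment)
  qed
  obtain B where B: "\<And>k. integral\<^sup>L (\<kappa> k) (bernstein_kernel 1) \<le> B"
    using convergent_imp_Bseq[OF conv[of 1]] unfolding Bseq_def by (auto simp: abs_le_iff)
  \<comment> \<open>The bound is made positive, so that it can be divided by.\<close>
  define C where "C = max B 1"
  have C: "0 < C" "\<And>k. integral\<^sup>L (\<kappa> k) (bernstein_kernel 1) \<le> C"
    using B by (auto simp: C_def le_max_iff_disj)
  show ?thesis
  proof (rule convergent_uniform_approx)
    fix e :: real assume "0 < e"
    have k1: "0 < bernstein_kernel 1 x" for x by (simp add: bernstein_kernel_pos)
    have k1': "bernstein_kernel 1 x \<noteq> 0" for x using k1[of x] by linarith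
    have cg: "continuous_on UNIV (\<lambda>x. g x / bernstein_kernel 1 x)"
      by (intro continuous_on_divide g ck) (simp add: k1')
    have "0 < e / C" using \<open>0 < e\<close> C(1) by simp
    then obtain p where p: "\<And>x. \<bar>g x / bernstein_kernel 1 x - poly p (expn x)\<bar> < e / C"
      using poly_expn_dense[OF cg] by blast
    have le: "\<bar>g x - poly p (expn x) * bernstein_kernel 1 x\<bar> \<le> e / C * bernstein_kernel 1 x" for x
    proof -
      have "g x - poly p (expn x) * bernstein_kernel 1 x = (g x / bernstein_kernel 1 x - poly p (expn x)) * bernstein_kernel 1 x"
        using k1[of x] by (simp add: field_simps)
      then show ?thesis
        using mult_right_mono[OF less_imp_le[OF p[of x]], of "bernstein_kernel 1 x"] k1[of x]
        by (simp only: abs_mult abs_of_pos less_imp_le)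
    qed
    have cp: "continuous_on UNIV (\<lambda>x. poly p (expn x) * bernstein_kernel 1 x)"
      by (intro continuous_on_mult continuous_on_poly continuous_on_expn ck)
    have "\<bar>integral\<^sup>L (\<kappa> k) g - (LINT x|\<kappa> k. poly p (expn x) * bernstein_kernel 1 x)\<bar> \<le> e" for k
    proof -
      have "\<bar>integral\<^sup>L (\<kappa> k) g - (LINT x|\<kappa> k. poly p (expn x) * bernstein_kernel 1 x)\<bar>
          = \<bar>LINT x|\<kappa> k. g x - poly p (expn x) * bernstein_kernel 1 x\<bar>"
        by (subst Bochner_Integration.integral_diff) (intro int g cp refl)+
      also have "\<dots> \<le> (LINT x|\<kappa> k. \<bar>g x - poly p (expn x) * bernstein_kernel 1 x\<bar>)"
        by (rule integral_abs_bound)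
      also have "\<dots> \<le> (LINT x|\<kappa> k. e / C * bernstein_kernel 1 x)"
        by (intro integral_mono le int continuous_on_rabs continuous_on_diff continuous_on_mult
          continuous_on_const g cp ck)
      also have "\<dots> \<le> e / C * C"
        using mult_left_mono[OF C(2)[of k], of "e / C"] C(1) \<open>0 < e\<close> by simp
      finally show ?thesis using C by simp
    qed
    with poly[of p] show "\<exists>v. convergent v \<and> (\<forall>k. \<bar>integral\<^sup>L (\<kappa> k) g - v k\<bar> \<le> e)" by blast
  qed
qed

section \<open>Finite measures on \<open>[0,\<infinity>]\<close> as limits\<close>

text \<open>The rays \<open>{a<..}\<close> generate the Borel sets, and the indicator of such a ray is the increasing
  limit of the continuous ramps \<open>0 \<or> (1 \<and> n (e\<^sup>-\<^sup>a - e\<^sup>-\<^sup>x))\<close>.\<close>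

lemma measure_eqI_continuous_ennreal:
  fixes \<kappa> \<kappa>' :: "ennreal measure"
  assumes fin: "finite_measure_extended \<kappa>" "finite_measure_extended \<kappa>'"
    and eq: "\<And>g :: ennreal \<Rightarrow> real. continuous_on UNIV g \<Longrightarrow> integral\<^sup>L \<kappa> g = integral\<^sup>L \<kappa>' g"
  shows "\<kappa> = \<kappa>'"
proof -
  have ray: "(\<lambda>n. LINT x|M. max 0 (min 1 (real n * (expn a - expn x)))) \<longlonglongrightarrow> measure M {a<..}"
    if M: "finite_measure_extended M" for M a
  proof -
    interpret finite_measure M using M by (simp add: finite_measure_extended_def)
    have s: "sets M = sets borel" and sp: "space M = UNIV"
      using M sets_eq_imp_space_eq[of M borel] by (auto simp: finite_measure_extended_def)
    have [measurable]: "expn \<in> borel_measurable M"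
      unfolding measurable_cong_sets[OF s refl]
      by (intro borel_measurable_continuous_onI continuous_on_expn)
    have [measurable]: "{a<..} \<in> sets M" by (simp add: s)
    have "(\<lambda>n. LINT x|M. max 0 (min 1 (real n * (expn a - expn x))))
       \<longlonglongrightarrow> (LINT x|M. indicator {a<..} x)"
    proof (rule integral_dominated_convergence[where w = "\<lambda>_. 1"])
      have "(\<lambda>n. max 0 (min 1 (real n * (expn a - expn x)))) \<longlonglongrightarrow> indicator {a<..} x" for x
      proof (cases "a < x")
        case True
        then have d: "0 < expn a - expn x" by (simp add: expn_less_iff)
        obtain N where N: "1 / (expn a - expn x) < real N" using reals_Archimedean2 by blast
        have "max 0 (min 1 (real n * (expn a - expn x))) = 1" if "N \<le> n" for n
        proof -
          have "1 / (expn a - expn x) < real n" using N that by (meson le_less_trans less_le_trans of_nat_le_iff)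
          then show ?thesis using d by (simp add: divide_less_eq min_def)
        qed
        then show ?thesis using True
          by (intro tendsto_eventually eventually_sequentiallyI[of N]) simp
      next
        case False
        then have "\<not> expn x < expn a" by (simp add: expn_less_iff)
        then have "expn a - expn x \<le> 0" by simp
        then have "max 0 (min 1 (real n * (expn a - expn x))) = 0" for n
          by (intro max_absorb1 min.coboundedI2 mult_nonneg_nonpos) simp_all
        then show ?thesis using False by simp
      qed
      then show "AE x in M. (\<lambda>n. max 0 (min 1 (real n * (expn a - expn x)))) \<longlonglongrightarrow> indicator {a<..} x"
        by simp
    qed auto
    then show ?thesis by (simp add: sp)
  qed
  have c: "continuous_on UNIV (\<lambda>x. max 0 (min 1 (real n * (expn a - expn x))))" for n a
    by (intro continuous_intros continuous_on_max continuous_on_min continuous_on_expn)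
  interpret K: finite_measure \<kappa> using fin by (simp add: finite_measure_extended_def)
  interpret K': finite_measure \<kappa>' using fin by (simp add: finite_measure_extended_def)
  have s: "sets \<kappa> = sets borel" "sets \<kappa>' = sets borel"
    using fin by (auto simp: finite_measure_extended_def)
  have sp: "space \<kappa> = UNIV" "space \<kappa>' = UNIV"
    using s[THEN sets_eq_imp_space_eq] by auto
  have rays: "measure \<kappa> {a<..} = measure \<kappa>' {a<..}" for a
    using ray[OF fin(1), of a] ray[OF fin(2), of a] unfolding eq[OF c] by (rule LIMSEQ_unique)
  have total: "measure \<kappa> UNIV = measure \<kappa>' UNIV"
    using eq[of "\<lambda>_. 1"] by (simp add: sp)
  let ?E = "insert UNIV (range greaterThan) :: ennreal set set"
  have E: "sets borel = sigma_sets UNIV ?E"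
  proof
    show "sets borel \<subseteq> sigma_sets UNIV ?E"
      by (subst borel_Ioi) (auto intro!: sigma_sets_mono' simp: sets_measure_of)
    show "sigma_sets UNIV ?E \<subseteq> sets borel"
      using sets.sigma_sets_subset[of ?E "borel :: ennreal measure"] unfolding space_borel
      by (rule meta_mp) auto
  qed
  show ?thesis
  proof (rule measure_eqI_generator_eq_countable[where E = ?E and \<Omega> = UNIV and A = "{UNIV}"])
    show "Int_stable ?E"
    proof -
      have "{a<..} \<inter> {b<..} = {max a b<..}" for a b :: ennreal by auto
      then show ?thesis by (auto simp: Int_stable_def)
    qed
    show "emeasure \<kappa> X = emeasure \<kappa>' X" if "X \<in> ?E" for X
      using that rays total by (auto simp: K.emeasure_eq_measure K'.emeasure_eq_measure)
  qed (auto simp: s E)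
qed

text \<open>The images under \<^const>\<open>expn\<close> live on \<open>[0,1]\<close>, so they are tight and a subsequence converges
  weakly on the real line. The limit is pulled back along a continuous function \<open>\<psi>\<close> that is defined
  on the whole line and inverts \<^const>\<open>expn\<close>; this avoids showing that the limit is carried by
  \<open>[0,1]\<close>.\<close>

lemma weak_star_compact_prob:
  fixes P :: "nat \<Rightarrow> ennreal measure"
  assumes prob: "\<And>k. prob_space (P k)" and sets: "\<And>k. sets (P k) = sets borel"
  obtains r Q where "strict_mono r" "prob_space Q" "sets Q = sets borel"
    "weak_star_limit (P \<circ> r) Q"
proof -
  have expn [measurable]: "expn \<in> borel_measurable borel"
    by (intro borel_measurable_continuous_onI continuous_on_expn)
  have expn_P [measurable]: "expn \<in> borel_measurable (P k)" for k
    by (simp add: measurable_cong_sets[OF sets refl])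
  define D where "D k = distr (P k) borel expn" for k
  have D: "real_distribution (D k)" for k
    unfolding D_def by (intro prob_space.real_distribution_distr prob expn_P)
  have "tight D"
    unfolding tight_def
  proof (intro conjI allI impI D)
    fix e :: real assume "0 < e"
    have "measure (D k) {-1<..1} = 1" for k
    proof -
      interpret prob_space "P k" by (rule prob)
      have "expn -` {-1<..1} = UNIV"
        using expn_le_1 expn_nonneg by (fastforce intro: less_le_trans[of "-1" 0])
      then show ?thesis
        by (simp add: D_def measure_distr prob_space)
    qed
    with \<open>0 < e\<close> show "\<exists>a b. a < b \<and> (\<forall>n. 1 - e < measure (D n) {a<..b})"
      by (intro exI[of _ "-1"] exI[of _ 1]) simp
  qed
  then obtain r M where r: "strict_mono r" and M: "real_distribution M"
      and lim: "weak_conv_m (\<lambda>n. D (r n)) M"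
    using tight_imp_convergent_subsubsequence[of D id] strict_mono_id by (auto simp: o_def)
  interpret M: real_distribution M by (rule M)
  define \<psi> where "\<psi> u = neg_ln (max 0 (min 1 u))" for u
  have c: "continuous_on UNIV \<psi>"
    unfolding \<psi>_def
    by (rule continuous_on_compose2[OF continuous_on_neg_ln])
      (auto intro!: continuous_intros continuous_on_max continuous_on_min)
  have [simp]: "\<psi> (expn x) = x" for x
    by (simp add: \<psi>_def expn_nonneg expn_le_1 max_absorb2)
  have \<psi> [measurable]: "\<psi> \<in> borel_measurable borel" "\<psi> \<in> borel_measurable M"
    using borel_measurable_continuous_onI[OF c] by simp_all
  define Q where "Q = distr M borel \<psi>"
  show thesis
  proof
    show "strict_mono r" by fact
    show "prob_space Q" unfolding Q_def by (intro M.prob_space_distr \<psi>)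
    show "sets Q = sets borel" by (simp add: Q_def)
    show "weak_star_limit (P \<circ> r) Q"
      unfolding weak_star_limit_def
    proof (intro allI impI)
      fix g :: "ennreal \<Rightarrow> real" assume g: "continuous_on UNIV g"
      obtain B where B: "\<And>x. \<bar>g x\<bar> \<le> B" using continuous_bounded_ennreal[OF g] by blast
      have g' [measurable]: "g \<in> borel_measurable borel" by (intro borel_measurable_continuous_onI g)
      have "continuous_on UNIV (\<lambda>u. g (\<psi> u))"
        by (rule continuous_on_compose2[OF g c]) simp
      then have "(\<lambda>n. LINT u|D (r n). g (\<psi> u)) \<longlonglongrightarrow> (LINT u|M. g (\<psi> u))"
        using B D M lim
        by (intro weak_conv_imp_integral_bdd_continuous_conv[where B = B])
          (auto simp: continuous_on_eq_continuous_at)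
      moreover have "(LINT u|D k. g (\<psi> u)) = integral\<^sup>L (P k) g" for k
        unfolding D_def by (subst integral_distr) auto
      moreover have "(LINT u|M. g (\<psi> u)) = integral\<^sup>L Q g"
        unfolding Q_def by (subst integral_distr) auto
      ultimately show "(\<lambda>k. integral\<^sup>L ((P \<circ> r) k) g) \<longlonglongrightarrow> integral\<^sup>L Q g"
        by simp
    qed
  qed
qed

text \<open>Since all the integrals converge already, it suffices to identify the limit along a
  subsequence. Compactness of probability measures applies after division by the total masses,
  provided that these do not tend to \<open>0\<close>; if they do, the limit is the null measure.\<close>

lemma weak_star_limit_exists:
  fixes \<kappa> :: "nat \<Rightarrow> ennreal measure"
  assumes fin: "\<And>k. finite_measure_extended (\<kappa> k)"
    and conv: "\<And>g :: ennreal \<Rightarrow> real. continuous_on UNIV g \<Longrightarrow> convergent (\<lambda>k. integral\<^sup>L (\<kappa> k) g)"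
  shows "\<exists>\<kappa>'. finite_measure_extended \<kappa>' \<and> weak_star_limit \<kappa> \<kappa>'"
proof -
  have s: "sets (\<kappa> k) = sets borel" and sp: "space (\<kappa> k) = UNIV" for k
    using fin[of k] sets_eq_imp_space_eq[of "\<kappa> k" borel] by (auto simp: finite_measure_extended_def)
  have fm: "finite_measure (\<kappa> k)" for k using fin by (simp add: finite_measure_extended_def)
  define m where "m k = measure (\<kappa> k) UNIV" for k
  have m: "m k = (LINT x|\<kappa> k. 1)" "0 \<le> m k" for k by (simp_all add: m_def sp)
  obtain m' where m': "m \<longlonglongrightarrow> m'"
    using conv[of "\<lambda>_. 1"] unfolding convergent_def m(1)[symmetric] by (auto simp only: continuous_on_const)
  have "0 \<le> m'" by (rule LIMSEQ_le_const[OF m']) (simp add: m(2))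
  then consider "m' = 0" | "0 < m'" by linarith
  then show ?thesis
  proof cases
    case 1
    have "weak_star_limit \<kappa> (null_measure borel)"
      unfolding weak_star_limit_def
    proof (intro allI impI)
      fix g :: "ennreal \<Rightarrow> real" assume g: "continuous_on UNIV g"
      obtain B where B: "\<And>x. \<bar>g x\<bar> \<le> B" using continuous_bounded_ennreal[OF g] by blast
      have "\<bar>integral\<^sup>L (\<kappa> k) g\<bar> \<le> B * m k" for k
      proof -
        have "\<bar>integral\<^sup>L (\<kappa> k) g\<bar> \<le> (LINT x|\<kappa> k. \<bar>g x\<bar>)" by (rule integral_abs_bound)
        also have "\<dots> \<le> (LINT x|\<kappa> k. B)"
          by (intro integral_mono integrable_continuous_ennreal fin continuous_on_rabs continuous_on_const g B)
        finally show ?thesis by (simp add: m_def sp mult.commute)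
      qed
      moreover have "(\<lambda>k. B * m k) \<longlonglongrightarrow> 0"
        using tendsto_mult_left[OF m', of B] 1 by simp
      ultimately have "(\<lambda>k. integral\<^sup>L (\<kappa> k) g) \<longlonglongrightarrow> 0"
        by (intro Lim_null_comparison[of "\<lambda>k. integral\<^sup>L (\<kappa> k) g"]) auto
      then show "(\<lambda>k. integral\<^sup>L (\<kappa> k) g) \<longlonglongrightarrow> integral\<^sup>L (null_measure borel) g"
        by (simp add: integral_null_measure)
    qed
    moreover have "finite_measure_extended (null_measure borel)"
      by (auto simp: finite_measure_extended_def intro!: finite_measureI)
    ultimately show ?thesis by blast
  next
    case 2
    \<comment> \<open>Finitely many \<open>m k\<close> may vanish; any probability measure will do for those \<open>k\<close>.\<close>
    define P where "P k = (if m k = 0 then return borel 0 else density (\<kappa> k) (\<lambda>_. ennreal (1 / m k)))" for k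
    have em: "emeasure (\<kappa> k) UNIV = ennreal (m k)" for k
      using finite_measure.emeasure_eq_measure[OF fm] by (simp add: m_def)
    have P: "prob_space (P k)" "sets (P k) = sets borel" for k
    proof -
      show "prob_space (P k)"
      proof (cases "m k = 0")
        case True then show ?thesis by (simp add: P_def prob_space_return)
      next
        case False
        with m(2)[of k] have mk: "0 < m k" by simp
        have "emeasure (density (\<kappa> k) (\<lambda>_. ennreal (1 / m k))) UNIV = ennreal (1 / m k) * ennreal (m k)"
          by (subst emeasure_density_const) (simp_all only: s em UNIV_I sets.top[of borel, unfolded space_borel])
        also have "\<dots> = 1" using mk by (subst ennreal_mult''[symmetric]) simp_all
        finally show ?thesis
          using False by (intro prob_spaceI) (simp only: P_def if_False space_density sp)
      qed
      show "sets (P k) = sets borel" by (simp add: P_def s)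
    qed
    have scale: "integral\<^sup>L (\<kappa> k) g = m k * integral\<^sup>L (P k) g" 
      if g: "continuous_on UNIV g" and "m k \<noteq> 0" for g k
    proof -
      have [measurable]: "g \<in> borel_measurable (\<kappa> k)"
        using integrable_continuous_ennreal[OF fin g] by auto
      have "integral\<^sup>L (P k) g = (LINT x|\<kappa> k. 1 / m k * g x)"
        using that(2) m(2)[of k] by (simp only: P_def if_False) (subst integral_density; simp)
      then show ?thesis using that(2) by simp
    qed
    obtain r Q where r: "strict_mono r" and Q: "prob_space Q" "sets Q = sets borel"
        and lim: "weak_star_limit (P \<circ> r) Q"
      by (rule weak_star_compact_prob[OF P])
    interpret Q: prob_space Q by fact
    let ?\<kappa> = "density Q (\<lambda>_. ennreal m')"
    have Qsp: "space Q = UNIV" using sets_eq_imp_space_eq[OF Q(2)] by simp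
    have "weak_star_limit \<kappa> ?\<kappa>"
      unfolding weak_star_limit_def
    proof (intro allI impI)
      fix g :: "ennreal \<Rightarrow> real" assume g: "continuous_on UNIV g"
      have [measurable]: "g \<in> borel_measurable Q"
        using borel_measurable_continuous_onI[OF g] by (simp add: measurable_cong_sets[OF Q(2) refl])
      obtain L where L: "(\<lambda>k. integral\<^sup>L (\<kappa> k) g) \<longlonglongrightarrow> L"
        using conv[OF g] by (auto simp: convergent_def)
      have "(\<lambda>k. m (r k) * integral\<^sup>L (P (r k)) g) \<longlonglongrightarrow> m' * integral\<^sup>L Q g"
        using lim[unfolded weak_star_limit_def, rule_format, OF g] LIMSEQ_subseq_LIMSEQ[OF m' r]
        unfolding o_def by (intro tendsto_mult)
      moreover have "\<forall>\<^sub>F k in sequentially. m (r k) * integral\<^sup>L (P (r k)) g = integral\<^sup>L (\<kappa> (r k)) g"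
      proof -
        have "\<forall>\<^sub>F k in sequentially. 0 < m (r k)"
          using order_tendstoD(1)[OF LIMSEQ_subseq_LIMSEQ[OF m' r] 2] by (simp add: o_def)
        then show ?thesis by eventually_elim (use scale[OF g] in simp)
      qed
      ultimately have l1: "(\<lambda>k. integral\<^sup>L (\<kappa> (r k)) g) \<longlonglongrightarrow> m' * integral\<^sup>L Q g"
        by (rule Lim_transform_eventually)
      have "(\<lambda>k. integral\<^sup>L (\<kappa> (r k)) g) \<longlonglongrightarrow> L"
        using LIMSEQ_subseq_LIMSEQ[OF L r] by (simp add: o_def)
      from this l1 have "L = m' * integral\<^sup>L Q g" by (rule LIMSEQ_unique)
      also have "\<dots> = integral\<^sup>L ?\<kappa> g" using 2 by (subst integral_density; simp)
      finally show "(\<lambda>k. integral\<^sup>L (\<kappa> k) g) \<longlonglongrightarrow> integral\<^sup>L ?\<kappa> g" using L by simp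
    qed
    moreover have "finite_measure_extended ?\<kappa>"
      unfolding finite_measure_extended_def
    proof
      show "sets ?\<kappa> = sets borel" by (simp only: sets_density Q)
      have "emeasure ?\<kappa> UNIV = ennreal m' * emeasure Q UNIV"
        by (subst emeasure_density_const) (simp_all only: Q UNIV_I sets.top[of borel, unfolded space_borel])
      also have "\<dots> = ennreal m'" using Q.emeasure_space_1 by (simp add: Qsp)
      finally show "finite_measure ?\<kappa>" by (intro finite_measureI) (simp add: Qsp)
    qed
    ultimately show ?thesis by blast
  qed
qed

section \<open>Levy triples correspond to finite measures on \<open>[0,\<infinity>]\<close>\<close>

text \<open>The inverse of \<^const>\<open>kappa\<close>: the atoms at the two end points give the constants, and the weight
  \<open>x \<and> 1\<close> is divided out on the open interval.\<close>

definition levy_of :: "ennreal measure \<Rightarrow> triple" where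
  "levy_of \<kappa> = (measure \<kappa> {0}, measure \<kappa> {\<top>},
     density (distr (restrict_space \<kappa> {0<..<\<top>}) (restrict_space borel {0<..}) enn2real)
       (\<lambda>x. ennreal (1 / min x 1)))"

lemma density_weight_cancel:
  fixes M :: "real measure"
  assumes s: "sets M = sets (restrict_space borel {0<..})"
  shows "density (density M (\<lambda>x. ennreal (1 / min x 1))) (\<lambda>x. ennreal (min x 1)) = M"
    and "density (density M (\<lambda>x. ennreal (min x 1))) (\<lambda>x. ennreal (1 / min x 1)) = M"
proof -
  have sp: "space M = {0<..}"
    using sets_eq_imp_space_eq[OF s] by (simp add: space_restrict_space)
  have m [measurable]: "h \<in> borel_measurable M" if "h \<in> borel_measurable borel"
    for h :: "real \<Rightarrow> ennreal"
    unfolding measurable_cong_sets[OF s refl] using that by (rule measurable_restrict_space1)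
  have m1: "(\<lambda>x. ennreal (min x 1)) \<in> borel_measurable M"
    and m2: "(\<lambda>x. ennreal (1 / min x 1)) \<in> borel_measurable M"
    by (rule m; measurable)+
  have one: "ennreal (1 / min x 1) * ennreal (min x 1) = 1" if "x \<in> space M" for x
    using that by (subst ennreal_mult''[symmetric]) (auto simp: sp)
  have "density M (\<lambda>x. ennreal (1 / min x 1) * ennreal (min x 1)) = density M (\<lambda>_. 1)"
    using one m1 m2 by (intro density_cong AE_I2) auto
  then show "density (density M (\<lambda>x. ennreal (1 / min x 1))) (\<lambda>x. ennreal (min x 1)) = M"
    and "density (density M (\<lambda>x. ennreal (min x 1))) (\<lambda>x. ennreal (1 / min x 1)) = M"
    by (simp_all add: density_density_eq[OF m1 m2] density_density_eq[OF m2 m1] mult.commute density_1)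
qed

lemma measurable_enn2real_positive:
  assumes "sets \<kappa> = sets borel"
  shows "enn2real \<in> measurable (restrict_space \<kappa> {0<..<\<top>}) (restrict_space borel {0<..})"
proof (rule measurable_restrict_space2)
  show "enn2real \<in> space (restrict_space \<kappa> {0<..<\<top>}) \<rightarrow> {0<..}"
    by (auto simp: space_restrict_space enn2real_positive_iff)
  have "enn2real \<in> borel_measurable \<kappa>"
    unfolding measurable_cong_sets[OF assms refl] by measurable
  then show "enn2real \<in> borel_measurable (restrict_space \<kappa> {0<..<\<top>})"
    by (rule measurable_restrict_space1)
qed

lemma
  assumes "finite_measure_extended \<kappa>"
  shows levy_triple_levy_of: "levy_triple (levy_of \<kappa>)"
    and kappa_levy_of: "kappa (levy_of \<kappa>) = \<kappa>"
proof -
  interpret finite_measure \<kappa> using assms by (simp add: finite_measure_extended_def)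
  have s: "sets \<kappa> = sets borel" using assms by (simp add: finite_measure_extended_def)
  have sp: "space \<kappa> = UNIV" using sets_eq_imp_space_eq[OF s] by simp
  let ?I = "{0<..<\<top>} :: ennreal set" and ?B = "restrict_space borel {0<..} :: real measure"
  let ?R = "restrict_space \<kappa> ?I"
  let ?D = "distr ?R ?B enn2real"
  let ?w = "\<lambda>x::real. ennreal (min x 1)"
  define \<mu> where "\<mu> = density ?D (\<lambda>x. ennreal (1 / min x 1))"
  note e = measurable_enn2real_positive[OF s]
  have s\<mu>: "sets \<mu> = sets ?B" by (simp add: \<mu>_def)
  have sp\<mu>: "space \<mu> = {0<..}"
    using sets_eq_imp_space_eq[OF s\<mu>] by (simp add: space_restrict_space)
  have D: "density \<mu> ?w = ?D"
    unfolding \<mu>_def by (rule density_weight_cancel) simp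
  have w: "?w \<in> borel_measurable \<mu>"
    unfolding measurable_cong_sets[OF s\<mu> refl] by (rule measurable_restrict_space1) measurable
  have "(\<integral>\<^sup>+x. ?w x \<partial>\<mu>) = emeasure (density \<mu> ?w) (space \<mu>)"
    by (subst emeasure_density[OF w sets.top]) (auto intro!: nn_integral_cong)
  also have "\<dots> = emeasure ?R (enn2real -` {0<..} \<inter> space ?R)"
    unfolding D sp\<mu> by (rule emeasure_distr[OF e]) (auto simp: sets_restrict_space)
  also have "\<dots> < \<infinity>"
    by (subst emeasure_restrict_space) (auto simp: s sp space_restrict_space emeasure_eq_measure)
  finally show "levy_triple (levy_of \<kappa>)"
    by (simp add: levy_of_def \<mu>_def[symmetric] s\<mu>)
  have en: "ennreal \<in> measurable ?B borel"
    by (rule measurable_restrict_space1) measurable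
  have I: "?I \<in> sets borel" by simp
  show "kappa (levy_of \<kappa>) = \<kappa>"
  proof (rule measure_eqI)
    show "sets (kappa (levy_of \<kappa>)) = sets \<kappa>" by (simp add: s)
    fix A assume "A \<in> sets (kappa (levy_of \<kappa>))"
    then have A: "A \<in> sets borel" by simp
    have "distr ?D borel ennreal = distr ?R borel (\<lambda>x. x)"
      unfolding distr_distr[OF en e]
      by (intro distr_cong refl) (auto simp: space_restrict_space less_top)
    moreover have "(\<lambda>x. x) \<in> measurable ?R borel"
      by (intro measurable_restrict_space1) (simp add: measurable_cong_sets[OF s refl])
    ultimately have d: "emeasure (distr ?D borel ennreal) A = emeasure \<kappa> (A \<inter> ?I)"
      using A I by (simp add: emeasure_distr emeasure_restrict_space s sp space_restrict_space)
    have "emeasure \<kappa> A = emeasure \<kappa> (A \<inter> {0} \<union> A \<inter> {\<top>} \<union> A \<inter> ?I)"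
      by (rule arg_cong[of _ _ "emeasure \<kappa>"]) (auto simp: less_top zero_less_iff_neq_zero)
    also have "\<dots> = emeasure \<kappa> (A \<inter> {0} \<union> A \<inter> {\<top>}) + emeasure \<kappa> (A \<inter> ?I)"
      using A I by (intro plus_emeasure[symmetric]) (auto simp: s)
    also have "emeasure \<kappa> (A \<inter> {0} \<union> A \<inter> {\<top>}) = emeasure \<kappa> (A \<inter> {0}) + emeasure \<kappa> (A \<inter> {\<top>})"
      using A by (intro plus_emeasure[symmetric]) (auto simp: s)
    also have "emeasure \<kappa> (A \<inter> {0}) = ennreal (measure \<kappa> {0}) * emeasure (return borel 0) A"
      using A by (auto simp: indicator_def emeasure_eq_measure)
    also have "emeasure \<kappa> (A \<inter> {\<top>}) = ennreal (measure \<kappa> {\<top>}) * emeasure (return borel \<infinity>) A"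
      using A by (auto simp: indicator_def emeasure_eq_measure)
    finally show "emeasure (kappa (levy_of \<kappa>)) A = emeasure \<kappa> A"
      unfolding levy_of_def \<mu>_def[symmetric] by (simp only: emeasure_kappa[OF A] D d)
  qed
qed

lemma levy_of_kappa:
  assumes "levy_triple T"
  shows "levy_of (kappa T) = T"
proof (cases T)
  case (fields a b \<mu>)
  have ab: "0 \<le> a" "0 \<le> b" and s: "sets \<mu> = sets (restrict_space borel {0<..})"
    using assms by (auto simp: fields)
  have sp: "space \<mu> = {0<..}"
    using sets_eq_imp_space_eq[OF s] by (simp add: space_restrict_space)
  let ?w = "\<lambda>x::real. ennreal (min x 1)"
  have en: "ennreal \<in> measurable (density \<mu> ?w) borel"
    unfolding measurable_cong_sets[OF trans[OF sets_density s] refl]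
    by (rule measurable_restrict_space1) measurable
  have d: "emeasure (distr (density \<mu> ?w) borel ennreal) A = emeasure (density \<mu> ?w) (ennreal -` A \<inter> {0<..})"
    if "A \<in> sets borel" for A
    by (subst emeasure_distr[OF en that]) (simp add: sp)
  have "ennreal -` {0} \<inter> {0<..} = {}" "ennreal -` {\<top>} \<inter> {0<..} = {}"
    by (auto simp: ennreal_eq_0_iff)
  then have atoms: "measure (kappa T) {0} = a" "measure (kappa T) {\<top>} = b"
    using ab by (simp_all add: measure_def fields emeasure_kappa d)
  let ?I = "{0<..<\<top>} :: ennreal set" and ?B = "restrict_space borel {0<..} :: real measure"
  have "distr (restrict_space (kappa T) ?I) ?B enn2real = density \<mu> ?w"
  proof (rule measure_eqI)
    show "sets (distr (restrict_space (kappa T) ?I) ?B enn2real) = sets (density \<mu> ?w)"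
      by (simp add: s)
    fix X assume "X \<in> sets (distr (restrict_space (kappa T) ?I) ?B enn2real)"
    then have X: "X \<in> sets ?B" by simp
    note e = measurable_enn2real_positive[OF sets_kappa]
    have X': "enn2real -` X \<inter> ?I \<in> sets borel"
      using measurable_sets[OF e X]
      by (subst (asm) sets_restrict_space_iff) (auto simp: space_restrict_space)
    have Xpos: "X \<subseteq> {0<..}" using sets.sets_into_space[OF X] by (simp add: space_restrict_space)
    have "emeasure (distr (restrict_space (kappa T) ?I) ?B enn2real) X
        = emeasure (kappa T) (enn2real -` X \<inter> ?I)"
      using X' by (subst emeasure_distr[OF e X], subst emeasure_restrict_space)
        (auto simp: space_restrict_space)
    also have "\<dots> = emeasure (density \<mu> ?w) (ennreal -` (enn2real -` X \<inter> ?I) \<inter> {0<..})"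
      using X' by (simp add: fields emeasure_kappa d)
    also have "ennreal -` (enn2real -` X \<inter> ?I) \<inter> {0<..} = X"
      using Xpos by auto
    finally show "emeasure (distr (restrict_space (kappa T) ?I) ?B enn2real) X = emeasure (density \<mu> ?w) X" .
  qed
  then show ?thesis
    unfolding levy_of_def atoms by (simp add: fields density_weight_cancel[OF s])
qed

section \<open>The continuity theorem\<close>

lemma weak_star_limit_of_convergent_bernstein:
  assumes "\<And>k. levy_triple (T k)" "\<And>q. 0 < q \<Longrightarrow> convergent (\<lambda>k. bernstein (T k) q)"
  shows "\<exists>\<kappa>. finite_measure_extended \<kappa> \<and> weak_star_limit (\<lambda>k. kappa (T k)) \<kappa>"
proof (rule weak_star_limit_exists)
  show fin: "finite_measure_extended (kappa (T k))" for k
    by (rule finite_measure_extended_kappa) (rule assms)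
  fix g :: "ennreal \<Rightarrow> real" assume g: "continuous_on UNIV g"
  have "convergent (\<lambda>k. integral\<^sup>L (kappa (T k)) (bernstein_kernel q))" if "0 < q" for q
    using assms(2)[OF that] by (simp only: bernstein_eq_integral_kappa[OF assms(1) that])
  then show "convergent (\<lambda>k. integral\<^sup>L (kappa (T k)) g)"
    by (rule convergent_integral_continuous[where \<kappa> = "\<lambda>k. kappa (T k)", OF fin _ g])
qed

lemma bernstein_tendsto:
  assumes "\<And>k. levy_triple (T k)" "weak_star_limit (\<lambda>k. kappa (T k)) \<kappa>" "0 < q"
  shows "(\<lambda>k. bernstein (T k) q) \<longlonglongrightarrow> integral\<^sup>L \<kappa> (bernstein_kernel q)"
  using assms(2)[unfolded weak_star_limit_def, rule_format, OF continuous_on_bernstein_kernel[OF assms(3)]]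
  by (simp only: bernstein_eq_integral_kappa[OF assms(1,3)])

text \<open>Uniqueness is a consequence of convergence: the alternating sequence \<open>S, S', S, S', \<dots>\<close> has
  constant transforms, so its continuous integrals converge, and an alternating sequence converges
  only if its two values agree.\<close>

lemma kappa_eq_of_bernstein_eq:
  assumes T: "levy_triple S" "levy_triple S'"
    and eq: "\<And>q. 0 < q \<Longrightarrow> bernstein S q = bernstein S' q"
  shows "kappa S = kappa S'"
proof (rule measure_eqI_continuous_ennreal)
  fix g :: "ennreal \<Rightarrow> real" assume g: "continuous_on UNIV g"
  define U where "U k = (if even k then S else S')" for k :: nat
  have U: "levy_triple (U k)" for k using T by (simp add: U_def)
  have "bernstein (U k) q = bernstein S q" if "0 < q" for q k
    using eq[OF that] by (simp add: U_def)
  then have "convergent (\<lambda>k. integral\<^sup>L (kappa (U k)) (bernstein_kernel q))" if "0 < q" for q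
    using that by (simp only: bernstein_eq_integral_kappa[OF U, symmetric] convergent_const)
  then have "convergent (\<lambda>k. integral\<^sup>L (kappa (U k)) g)"
    by (rule convergent_integral_continuous[where \<kappa> = "\<lambda>k. kappa (U k)",
          OF finite_measure_extended_kappa[OF U] _ g])
  then obtain L where L: "(\<lambda>k. integral\<^sup>L (kappa (U k)) g) \<longlonglongrightarrow> L"
    by (auto simp: convergent_def)
  have "strict_mono (\<lambda>k::nat. 2 * k)" "strict_mono (\<lambda>k::nat. Suc (2 * k))"
    by (auto simp: strict_mono_def)
  from this[THEN LIMSEQ_subseq_LIMSEQ[OF L]]
  have "integral\<^sup>L (kappa S) g = L" "integral\<^sup>L (kappa S') g = L"
    by (simp_all add: U_def o_def LIMSEQ_const_iff)
  then show "integral\<^sup>L (kappa S) g = integral\<^sup>L (kappa S') g" by simp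
qed (use T in \<open>simp_all add: finite_measure_extended_kappa\<close>)

theorem theoremA6:
  fixes T :: "nat \<Rightarrow> triple"
  assumes "\<And>k. levy_triple (T k)"
  shows "((\<forall>q>0. convergent (\<lambda>k. bernstein (T k) q)) \<longleftrightarrow>
          (\<exists>\<kappa>. finite_measure_extended \<kappa> \<and> weak_star_limit (\<lambda>k. kappa (T k)) \<kappa>)) \<and>
         ((\<forall>q>0. convergent (\<lambda>k. bernstein (T k) q)) \<or>
          (\<exists>\<kappa>. finite_measure_extended \<kappa> \<and> weak_star_limit (\<lambda>k. kappa (T k)) \<kappa>) \<longrightarrow>
          (\<exists>f. \<forall>q>0. (\<lambda>k. bernstein (T k) q) \<longlonglongrightarrow> f q) \<and>
          (\<exists>\<kappa>. finite_measure_extended \<kappa> \<and> weak_star_limit (\<lambda>k. kappa (T k)) \<kappa>) \<and>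
          (\<forall>f \<kappa>. (\<forall>q>0. (\<lambda>k. bernstein (T k) q) \<longlonglongrightarrow> f q) \<and>
                 finite_measure_extended \<kappa> \<and> weak_star_limit (\<lambda>k. kappa (T k)) \<kappa> \<longrightarrow>
             (\<exists>S. levy_triple S \<and> (\<forall>q>0. f q = bernstein S q) \<and> \<kappa> = kappa S \<and>
                (\<forall>S'. levy_triple S' \<and> (\<forall>q>0. f q = bernstein S' q) \<longrightarrow> S' = S) \<and>
                (\<forall>S'. levy_triple S' \<and> \<kappa> = kappa S' \<longrightarrow> S' = S))))"
    (is "(?F \<longleftrightarrow> ?K) \<and> (?F \<or> ?K \<longrightarrow> ?L \<and> ?K \<and> ?U)")
proof -
  have FK: ?K if ?F
    by (rule weak_star_limit_of_convergent_bernstein[OF assms]) (use that in blast)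
  have KL: ?L if K: ?K
  proof -
    obtain \<kappa> where "weak_star_limit (\<lambda>k. kappa (T k)) \<kappa>" using K by blast
    from bernstein_tendsto[OF assms this]
    show ?thesis by (intro exI[of _ "\<lambda>q. integral\<^sup>L \<kappa> (bernstein_kernel q)"] allI impI)
  qed
  have LF: ?F if ?L
    using that unfolding convergent_def by blast
  have "\<exists>S. levy_triple S \<and> (\<forall>q>0. f q = bernstein S q) \<and> \<kappa> = kappa S \<and>
      (\<forall>S'. levy_triple S' \<and> (\<forall>q>0. f q = bernstein S' q) \<longrightarrow> S' = S) \<and>
      (\<forall>S'. levy_triple S' \<and> \<kappa> = kappa S' \<longrightarrow> S' = S)"
    if f: "\<forall>q>0. (\<lambda>k. bernstein (T k) q) \<longlonglongrightarrow> f q"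
      and \<kappa>: "finite_measure_extended \<kappa>" "weak_star_limit (\<lambda>k. kappa (T k)) \<kappa>" for f \<kappa>
  proof -
    define S where "S = levy_of \<kappa>"
    have S: "levy_triple S" "kappa S = \<kappa>"
      unfolding S_def by (rule levy_triple_levy_of[OF \<kappa>(1)] kappa_levy_of[OF \<kappa>(1)])+
    have fS: "f q = bernstein S q" if "0 < q" for q
    proof -
      have "f q = integral\<^sup>L \<kappa> (bernstein_kernel q)"
        by (rule LIMSEQ_unique[OF f[rule_format, OF that] bernstein_tendsto[OF assms \<kappa>(2) that]])
      then show ?thesis using S that by (simp add: bernstein_eq_integral_kappa)
    qed
    have uK: "S' = S" if "levy_triple S'" "\<kappa> = kappa S'" for S'
      using levy_of_kappa[OF that(1)] that(2) by (simp add: S_def)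
    have uF: "S' = S" if S': "levy_triple S'" "\<forall>q>0. f q = bernstein S' q" for S'
    proof (rule uK[OF S'(1)])
      have "kappa S = kappa S'"
        by (rule kappa_eq_of_bernstein_eq[OF S(1) S'(1)]) (use fS S'(2) in simp)
      then show "\<kappa> = kappa S'" by (simp add: S(2))
    qed
    show ?thesis using S fS uK uF by blast
  qed
  then have ?U by blast
  with FK KL LF show ?thesis by blast
qed

end
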